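(* Let $\ell \ge 1$, $m \ge 2$ and $n = (3\ell+1)m$ (so $n \ge 6\ell+2$). Let $D$ be a minimum porous exponential dominating set of $C_{n,[\ell]}$. Then for every integer $s$ and every $0 \le i \le m-1$, the interval $[\,s+(3\ell+1)i,\ s+(3\ell+1)i+3\ell\,]$ contains exactly one vertex of $D$ (equivalently, for every such partition $\mathcal{I}$ of the vertex set into $m$ consecutive intervals of $3\ell+1$ vertices, $f^*(D,\mathcal{I}) = 1$ and $Z(D,\mathcal{I}) = 0$). Furthermore, $D$ is unique up to isomorphism, i.e. $D = \{c + (3\ell+1)t \bmod n : 0 \le t \le m-1\}$ for some vertex $c$.
   Context: $C_{n,[\ell]}$ has vertex set $\{0,\dots,n-1\}$ (mod $n$), with $v$ adjacent to $v\pm i \bmod n$ for $i\in\{1,\dots,\ell\}$. $\mathrm{dist}(u,v)$ is the shortest-path distance. $D\subseteq V$ is a porous exponential dominating set if $\sum_{d\in D}(1/2)^{\mathrm{dist}(d,v)-1}\ge 1$ for every vertex $v$; minimum means of minimum cardinality. For $i,j$, the interval $[i,j]$ is the set of consecutive integers mod $n$ going upward from $i$ to $j$. For a partition $\mathcal{I}=\bigcup_{k=0}^{m-1} I_k$ of the vertices into consecutive intervals, $f_k(D,\mathcal{I}) = |I_k\cap D|$, $f^*(D,\mathcal{I})=\max_k f_k(D,\mathcal{I})$, $z(D,\mathcal{I}) = \{k : f_k(D,\mathcal{I})=0\}$, $Z(D,\mathcal{I}) = |z(D,\mathcal{I})|$. *)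

theory Defs
  imports Complex_Main "HOL-Library.Disjoint_Sets"
begin

definition circ_verts :: "nat \<Rightarrow> int set" where
  "circ_verts n = {0..<int n}"

definition circ_edges :: "nat \<Rightarrow> nat \<Rightarrow> (int \<times> int) set" where
  "circ_edges n l = {(u, v). u \<in> circ_verts n \<and> v \<in> circ_verts n \<and>
     (\<exists>i\<in>{1..int l}. v = (u + i) mod int n \<or> v = (u - i) mod int n)}"

text \<open>The pairs in \<open>E ^^ k\<close> are those joined by a walk of length \<open>k\<close>, so the least such \<open>k\<close>
  is the shortest-path distance. It is meaningful only for vertices in the same component.\<close>

definition graph_dist :: "('a \<times> 'a) set \<Rightarrow> 'a \<Rightarrow> 'a \<Rightarrow> nat" where
  "graph_dist E u v = (LEAST k. (u, v) \<in> E ^^ k)"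

text \<open>The exponent is an integer: a vertex of \<open>D\<close> contributes weight \<open>2\<close> to itself.\<close>

definition porous_exp_dominating :: "'a set \<Rightarrow> ('a \<times> 'a) set \<Rightarrow> 'a set \<Rightarrow> bool" where
  "porous_exp_dominating V E D \<longleftrightarrow> D \<subseteq> V \<and>
     (\<forall>v\<in>V. (\<Sum>d\<in>D. (1 / 2 :: real) powi (int (graph_dist E d v) - 1)) \<ge> 1)"

definition min_porous_exp_dominating :: "'a set \<Rightarrow> ('a \<times> 'a) set \<Rightarrow> 'a set \<Rightarrow> bool" where
  "min_porous_exp_dominating V E D \<longleftrightarrow> porous_exp_dominating V E D \<and>
     (\<forall>D'. porous_exp_dominating V E D' \<longrightarrow> card D \<le> card D')"

definition graph_automorphism :: "'a set \<Rightarrow> ('a \<times> 'a) set \<Rightarrow> ('a \<Rightarrow> 'a) \<Rightarrow> bool" where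
  "graph_automorphism V E \<phi> \<longleftrightarrow> bij_betw \<phi> V V \<and>
     (\<forall>u\<in>V. \<forall>v\<in>V. (u, v) \<in> E \<longleftrightarrow> (\<phi> u, \<phi> v) \<in> E)"

text \<open>The endpoints \<open>i\<close> and \<open>j\<close> are arbitrary integers representing residues modulo \<open>n\<close>; going
  upward from \<open>i\<close>, the residue of \<open>j\<close> is first reached after \<open>(j - i) mod n\<close> steps.\<close>

definition circ_interval :: "nat \<Rightarrow> int \<Rightarrow> int \<Rightarrow> int set" where
  "circ_interval n i j = (\<lambda>k. k mod int n) ` {i..i + (j - i) mod int n}"

definition interval_partition :: "nat \<Rightarrow> nat \<Rightarrow> (nat \<Rightarrow> int set) \<Rightarrow> bool" where
  "interval_partition n m I \<longleftrightarrow>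
     (\<forall>k<m. \<exists>a b. I k = circ_interval n a b) \<and>
     disjoint_family_on I {..<m} \<and> (\<Union>k<m. I k) = circ_verts n"

definition f_count :: "'a set \<Rightarrow> (nat \<Rightarrow> 'a set) \<Rightarrow> nat \<Rightarrow> nat" where
  "f_count D I k = card (I k \<inter> D)"

definition f_star :: "nat \<Rightarrow> 'a set \<Rightarrow> (nat \<Rightarrow> 'a set) \<Rightarrow> nat" where
  "f_star m D I = Max (f_count D I ` {..<m})"

definition z_set :: "nat \<Rightarrow> 'a set \<Rightarrow> (nat \<Rightarrow> 'a set) \<Rightarrow> nat set" where
  "z_set m D I = {k. k < m \<and> f_count D I k = 0}"

definition Z_count :: "nat \<Rightarrow> 'a set \<Rightarrow> (nat \<Rightarrow> 'a set) \<Rightarrow> nat" where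
  "Z_count m D I = card (z_set m D I)"

end

theory Submission imports Defs begin

text \<open>Let \<open>K = 3l + 1\<close>. The residue classes modulo \<open>K\<close> are dominating, so \<open>D\<close> has at most \<open>m\<close>
  points and its gaps average at least \<open>K\<close>; the claim is that all of them equal \<open>K\<close>.
  Read around the cycle in each of the two directions, every gap \<open>g \<le> K\<close> earns a credit \<open>K - g\<close>,
  and every gap \<open>g > K\<close> takes \<open>2(g - K) + 1\<close> from the credit accumulated so far, as far as
  available. If a gap \<open>g > K\<close> meets credits \<open>C\<close> and \<open>B\<close> from its two sides with
  \<open>C + B \<le> 2(g - K)\<close>, then the points of \<open>D\<close> near it are so sparse that some vertex inside the
  gap receives weight below \<open>1\<close>. Hence every long gap removes more than twice its excess from the
  two accounts, while a short gap adds its deficit to both. The accounts return to their initial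
  values after one turn, so long gaps would force the average gap below \<open>K\<close>.\<close>

section \<open>Weights received inside a gap\<close>

definition decay :: "nat \<Rightarrow> int \<Rightarrow> real" where
  "decay l z = 2 * (1 / 2) ^ nat \<lceil>real_of_int z / real l\<rceil>"

lemma decay_nonneg: "0 \<le> decay l z"
  by (simp add: decay_def)

lemma decay_antimono: "y \<le> z \<Longrightarrow> decay l z \<le> decay l y"
  unfolding decay_def
  by (intro mult_left_mono power_decreasing nat_mono ceiling_mono divide_right_mono) auto

lemma nat_ceiling_divide_le_iff:
  assumes "0 < l"
  shows "nat \<lceil>real_of_int z / real l\<rceil> \<le> q \<longleftrightarrow> z \<le> int q * int l"
proof -
  have "nat \<lceil>real_of_int z / real l\<rceil> \<le> q \<longleftrightarrow> real_of_int z \<le> real_of_int (int q * int l)"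
    using assms by (simp add: nat_le_iff ceiling_le_iff pos_divide_le_eq)
  then show ?thesis by (simp only: of_int_le_iff)
qed

lemma decay_le_power:
  assumes "0 < l" and "int q * int l < z"
  shows "decay l z \<le> (1 / 2) ^ q"
proof -
  have "Suc q \<le> nat \<lceil>real_of_int z / real l\<rceil>"
    using assms nat_ceiling_divide_le_iff[of l z q] by linarith
  then have "(1 / 2 :: real) ^ nat \<lceil>real_of_int z / real l\<rceil> \<le> (1 / 2) ^ Suc q"
    by (intro power_decreasing) auto
  then show ?thesis by (simp add: decay_def)
qed

lemma power_le_decay:
  assumes "0 < l" and "z \<le> int q * int l"
  shows "2 * (1 / 2) ^ q \<le> decay l z"
  using nat_ceiling_divide_le_iff[OF assms(1), THEN iffD2, OF assms(2)] unfolding decay_def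
  by (intro mult_left_mono power_decreasing) auto

lemma decay_add_step:
  assumes "0 < l" and "0 \<le> z"
  shows "decay l (z + int l) = decay l z / 2"
proof -
  have "real_of_int (z + int l) / real l = real_of_int z / real l + 1"
    using assms(1) by (simp add: field_simps)
  moreover have "0 \<le> \<lceil>real_of_int z / real l\<rceil>"
    using assms by (simp add: order_less_le_trans[of "-1" 0])
  ultimately show ?thesis by (simp add: decay_def nat_add_distrib)
qed

lemma sum_le_of_shift_contraction:
  fixes h :: "nat \<Rightarrow> real"
  assumes shift: "\<And>k. h (k + p) \<le> r * h k" and nonneg: "\<And>k. 0 \<le> h k" and r: "r < 1"
  shows "(\<Sum>k<M. h k) \<le> (\<Sum>k<p. h k) / (1 - r)"
proof -
  have "(\<Sum>k<M. h k) \<le> (\<Sum>k<p + M. h k)"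
    by (intro sum_mono2) (auto simp: nonneg)
  also have "\<dots> = (\<Sum>k<p. h k) + (\<Sum>k<M. h (k + p))"
    using sum.atLeastLessThan_concat[of 0 p "p + M" h]
      sum.shift_bounds_nat_ivl[of h 0 p M] by (simp add: atLeast0LessThan add.commute)
  also have "\<dots> \<le> (\<Sum>k<p. h k) + r * (\<Sum>k<M. h k)"
    unfolding sum_distrib_left by (intro add_left_mono sum_mono shift)
  finally show ?thesis using r by (simp add: field_simps)
qed

lemma sum_half_power_three_halves_le:
  "(\<Sum>k<M. (1 / 2 :: real) ^ ((3 * k + a) div 2))
     \<le> 8 / 7 * ((1 / 2) ^ (a div 2) + (1 / 2) ^ ((a + 3) div 2))"
proof -
  have "(1 / 2 :: real) ^ ((3 * (k + 2) + a) div 2) \<le> 1 / 8 * (1 / 2) ^ ((3 * k + a) div 2)" for k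
  proof -
    have "3 * (k + 2) + a = 3 * k + a + 3 * 2" by simp
    then have "(3 * (k + 2) + a) div 2 = (3 * k + a) div 2 + 3" by simp
    then show ?thesis by (simp add: power_add power3_eq_cube)
  qed
  then have "(\<Sum>k<M. (1 / 2 :: real) ^ ((3 * k + a) div 2))
      \<le> (\<Sum>k<2. (1 / 2) ^ ((3 * k + a) div 2)) / (1 - 1 / 8)"
    by (intro sum_le_of_shift_contraction) auto
  then show ?thesis by (simp add: lessThan_nat_numeral ring_distribs add.commute)
qed

text \<open>\<open>x k\<close> stands for the distance from the nearest point of \<open>D\<close> on one side of a gap to the \<open>k\<close>-th
  point behind it, and \<open>C\<close> for the credit accumulated on that side. The first alternative is the
  case that none of the \<open>k\<close> gaps in between exceeds \<open>K\<close>, the second one that some gap does.\<close>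

definition spread :: "int \<Rightarrow> nat \<Rightarrow> int \<Rightarrow> (nat \<Rightarrow> int) \<Rightarrow> bool" where
  "spread K M C x \<longleftrightarrow> x 0 = 0 \<and> (\<forall>k\<le>M. 0 \<le> x k) \<and>
     (\<forall>k. 1 \<le> k \<and> k \<le> M \<longrightarrow> int k * K - C \<le> x k \<or> (int k + 1) * K - 1 - C \<le> 2 * x k)"

definition load :: "nat \<Rightarrow> nat \<Rightarrow> (nat \<Rightarrow> int) \<Rightarrow> int \<Rightarrow> real" where
  "load l M x y = (\<Sum>k\<le>M. decay l (y + x k))"

lemma spread_mono: "spread K M C x \<Longrightarrow> C \<le> C' \<Longrightarrow> spread K M C' x"
  unfolding spread_def by fastforce

lemma spread_first_ge:
  assumes "spread K M C x" and "0 \<le> C" and "1 \<le> M"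
  shows "K - C \<le> x 1"
  using assms unfolding spread_def by (auto dest!: spec[of _ 1])

lemma spread_later_ge:
  assumes x: "spread K M C x" and C: "C \<le> K + 1" and K: "0 \<le> K" and k: "2 \<le> k" "k \<le> M"
  shows "(int k + 1) * K - 1 - C \<le> 2 * x k"
proof -
  have "2 * K \<le> int k * K" using k K by (intro mult_right_mono) auto
  moreover have "int k * K - C \<le> x k \<or> (int k + 1) * K - 1 - C \<le> 2 * x k"
    using x k by (auto simp: spread_def)
  ultimately show ?thesis using C by (auto simp: algebra_simps)
qed

lemma decay_later_le:
  assumes l: "0 < l" and x: "spread (3 * int l + 1) M C x" and C: "C \<le> 2 * int l"
    and s: "int s * int l \<le> 2 * y + 3 * int l - C" and k: "2 \<le> k" "k \<le> M"
  shows "decay l (y + x k) \<le> (1 / 2) ^ ((3 * k + s) div 2)"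
proof -
  have "(int k + 1) * (3 * int l + 1) - 1 - C \<le> 2 * x k"
    using C by (intro spread_later_ge[OF x _ _ k]) auto
  then have "(3 * int k + int s) * int l < 2 * (y + x k)"
    using s k by (simp add: algebra_simps)
  moreover have "2 * int ((3 * k + s) div 2) * int l \<le> (3 * int k + int s) * int l"
    by (intro mult_right_mono) linarith+
  ultimately show ?thesis by (intro decay_le_power[OF l]) simp
qed

definition one_sided_load :: "nat \<Rightarrow> int \<Rightarrow> (int \<Rightarrow> real) \<Rightarrow> bool" where
  "one_sided_load l C F \<longleftrightarrow> (\<exists>M x. spread (3 * int l + 1) M C x \<and> F = load l M x)"

lemma one_sided_load_le:
  assumes l: "0 < l" and F: "one_sided_load l C F" and C: "0 \<le> C" "C \<le> 2 * int l"
    and p: "int p * int l < y"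
    and q: "int q * int l < y + (3 * int l + 1) - C"
    and s: "int s * int l \<le> 2 * y + 3 * int l - C"
  shows "F y \<le> (1 / 2) ^ p + (1 / 2) ^ q
           + 8 / 7 * ((1 / 2) ^ ((6 + s) div 2) + (1 / 2) ^ ((9 + s) div 2))"
proof -
  obtain M x where x: "spread (3 * int l + 1) M C x" and F_eq: "F = load l M x"
    using F by (auto simp: one_sided_load_def)
  define bound :: "nat \<Rightarrow> real" where
    "bound k = (if k = 0 then (1 / 2) ^ p else if k = 1 then (1 / 2) ^ q
                else (1 / 2) ^ ((3 * k + s) div 2))" for k
  have decay_le_bound: "decay l (y + x k) \<le> bound k" if k: "k \<le> M" for k
  proof -
    consider "k = 0" | "k = 1" | "2 \<le> k" by linarith
    then show ?thesis
    proof cases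
      case 1
      moreover have "x 0 = 0" using x by (simp add: spread_def)
      ultimately show ?thesis using decay_le_power[OF l p] by (simp add: bound_def)
    next
      case 2
      then have "int q * int l < y + x k" using spread_first_ge[OF x C(1)] q k by simp
      then show ?thesis using decay_le_power[OF l] 2 by (simp add: bound_def)
    next
      case 3
      then show ?thesis using decay_later_le[OF l x C(2) s 3 k] by (simp add: bound_def)
    qed
  qed
  have "F y \<le> (\<Sum>k<M + 2. bound k)"
    unfolding F_eq load_def
    by (intro order_trans[OF sum_mono[OF decay_le_bound] sum_mono2]) (auto simp: bound_def)
  also have "\<dots> = bound 0 + bound 1 + (\<Sum>k<M. bound (k + 2))"
    by (simp only: add_2_eq_Suc' sum.lessThan_Suc_shift) simp
  also have "\<dots> = (1 / 2) ^ p + (1 / 2) ^ q + (\<Sum>k<M. (1 / 2) ^ ((3 * k + (6 + s)) div 2))"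
    by (simp add: bound_def algebra_simps)
  also have "(\<Sum>k<M. (1 / 2 :: real) ^ ((3 * k + (6 + s)) div 2))
      \<le> 8 / 7 * ((1 / 2) ^ ((6 + s) div 2) + (1 / 2) ^ ((9 + s) div 2))"
    using sum_half_power_three_halves_le[of "6 + s" M] by (simp add: add.commute)
  finally show ?thesis by simp
qed

definition merge_nearest :: "(nat \<Rightarrow> int) \<Rightarrow> nat \<Rightarrow> int" where
  "merge_nearest x k = (if k = 0 then 0 else x (Suc k))"

lemma spread_merge_nearest:
  assumes "spread K M C x"
  shows "spread K (M - 1) (C - K) (merge_nearest x)"
  unfolding spread_def
proof (intro conjI allI impI)
  fix k assume k: "1 \<le> k \<and> k \<le> M - 1"
  then have "1 \<le> Suc k \<and> Suc k \<le> M" by auto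
  then have "int (Suc k) * K - C \<le> x (Suc k) \<or> (int (Suc k) + 1) * K - 1 - C \<le> 2 * x (Suc k)"
    using assms unfolding spread_def by blast
  then show "int k * K - (C - K) \<le> merge_nearest x k \<or>
      (int k + 1) * K - 1 - (C - K) \<le> 2 * merge_nearest x k"
    using k by (auto simp: merge_nearest_def algebra_simps)
qed (use assms in \<open>auto simp: spread_def merge_nearest_def\<close>)

text \<open>A point at distance \<open>y\<close> weighs as much as two points at distance \<open>y + l\<close>.\<close>

lemma load_add_step_le_load_merge_nearest:
  assumes l: "0 < l" and x: "spread K M C x" and y: "0 \<le> y"
  shows "load l M x (y + int l) \<le> load l (M - 1) (merge_nearest x) y"
proof -
  have "decay l (y + int l + x k) = decay l (y + x k) / 2" if "k \<le> M" for k
    using decay_add_step[OF l, of "y + x k"] x y that by (simp add: spread_def ac_simps)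
  then have half: "load l M x (y + int l) = load l M x y / 2"
    unfolding load_def sum_divide_distrib by (intro sum.cong) auto
  have x0: "x 0 = 0" using x by (simp add: spread_def)
  show ?thesis
  proof (cases M)
    case 0
    then show ?thesis
      unfolding half by (simp add: load_def merge_nearest_def x0 decay_nonneg)
  next
    case (Suc M')
    have "decay l (y + x k) \<le> decay l y" if "k \<le> M" for k
      using x that by (intro decay_antimono) (simp add: spread_def)
    then have first: "decay l (y + x 1) \<le> decay l y" using Suc by simp
    have "load l M x y = decay l y + decay l (y + x 1) + (\<Sum>k<M'. decay l (y + x (Suc (Suc k))))"
      unfolding load_def Suc sum.atMost_Suc_shift
      by (simp add: x0 lessThan_Suc_atMost[symmetric] sum.lessThan_Suc_shift del: sum.lessThan_Suc)
    moreover have "load l M' (merge_nearest x) y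
        = decay l y + (\<Sum>k<M'. decay l (y + x (Suc (Suc k))))"
      unfolding load_def
      by (simp add: merge_nearest_def lessThan_Suc_atMost[symmetric] sum.lessThan_Suc_shift
          del: sum.lessThan_Suc)
    moreover have "0 \<le> (\<Sum>k<M'. decay l (y + x (Suc (Suc k))))"
      by (intro sum_nonneg decay_nonneg)
    ultimately show ?thesis unfolding half using first Suc by simp
  qed
qed

lemma one_sided_load_merge_nearest:
  assumes l: "0 < l" and F: "one_sided_load l C F"
  obtains F' where "one_sided_load l (C - 2 * int l) F'" and "\<And>y. 0 \<le> y \<Longrightarrow> F (y + int l) \<le> F' y"
proof -
  obtain M x where x: "spread (3 * int l + 1) M C x" and F_eq: "F = load l M x"
    using F by (auto simp: one_sided_load_def)
  show thesis
  proof (rule that)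
    have "spread (3 * int l + 1) (M - 1) (C - 2 * int l) (merge_nearest x)"
      by (rule spread_mono[OF spread_merge_nearest[OF x]]) simp
    then show "one_sided_load l (C - 2 * int l) (load l (M - 1) (merge_nearest x))"
      by (auto simp: one_sided_load_def)
  qed (unfold F_eq, rule load_add_step_le_load_merge_nearest[OF l x])
qed

definition underloaded :: "nat \<Rightarrow> int \<Rightarrow> (int \<Rightarrow> real) \<Rightarrow> (int \<Rightarrow> real) \<Rightarrow> bool" where
  "underloaded l e F G \<longleftrightarrow>
     (\<exists>a b. 1 \<le> a \<and> 1 \<le> b \<and> a + b = 3 * int l + 1 + e \<and> F a + G b < 1)"

lemma underloaded_commute: "underloaded l e F G \<longleftrightarrow> underloaded l e G F"
  unfolding underloaded_def by (metis add.commute)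

text \<open>With both credits at most \<open>2l\<close>, either the two sides contribute less than \<open>11/16\<close> and \<open>5/16\<close>
  to a vertex about \<open>l\<close> from one end of the gap, or each contributes less than \<open>1/2\<close> to a vertex
  at distance more than \<open>2l\<close> from both ends.\<close>

lemma underloaded_of_small_credit:
  assumes l: "0 < l" and F: "one_sided_load l C F" and G: "one_sided_load l B G"
    and B: "0 \<le> B" "B \<le> C" "C \<le> 2 * int l" and e: "1 \<le> e" "C + B \<le> 2 * e"
  shows "underloaded l e F G"
proof (cases "C + B \<le> 2 * int l + 2")
  case True
  define b where "b = 2 * int l + max 1 B"
  define a where "a = 3 * int l + 1 + e - b"
  have a: "int 1 * int l < a" "int 3 * int l < a + (3 * int l + 1) - C"
    "int 4 * int l \<le> 2 * a + 3 * int l - C"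
    using B e True l by (auto simp: a_def b_def max_def split: if_splits)
  have b: "int 2 * int l < b" "int 5 * int l < b + (3 * int l + 1) - B"
    "int 7 * int l \<le> 2 * b + 3 * int l - B"
    using B by (auto simp: b_def max_def)
  have "F a < 11 / 16"
    using one_sided_load_le[OF l F _ B(3) a] B by (simp add: power_divide)
  moreover have "G b < 5 / 16"
    using one_sided_load_le[OF l G _ _ b] B by (simp add: power_divide)
  ultimately show ?thesis
    using a(1) b(1) l unfolding underloaded_def
    by (intro exI[of _ a] exI[of _ b]) (auto simp: a_def)
next
  case False
  define b where "b = 2 * int l + 1"
  define a where "a = 3 * int l + 1 + e - b"
  have a: "int 2 * int l < a" "int 3 * int l < a + (3 * int l + 1) - C"
    "int 5 * int l \<le> 2 * a + 3 * int l - C"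
    using B e False by (auto simp: a_def b_def)
  have b: "int 2 * int l < b" "int 3 * int l < b + (3 * int l + 1) - B"
    "int 5 * int l \<le> 2 * b + 3 * int l - B"
    using B by (auto simp: b_def)
  have "F a < 1 / 2"
    using one_sided_load_le[OF l F _ B(3) a] B by (simp add: power_divide)
  moreover have "G b < 1 / 2"
    using one_sided_load_le[OF l G _ _ b] B by (simp add: power_divide)
  ultimately show ?thesis
    using a(1) b(1) l unfolding underloaded_def
    by (intro exI[of _ a] exI[of _ b]) (auto simp: a_def)
qed

lemma underloaded_of_credit_le:
  assumes l: "0 < l" and "one_sided_load l C F" and "one_sided_load l B G"
    and "0 \<le> C" and "0 \<le> B" and "1 \<le> e" and "C + B \<le> 2 * e"
  shows "underloaded l e F G"
  using assms(2-)
proof (induction "nat e" arbitrary: e C F B G rule: less_induct)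
  case less
  have ordered: "underloaded l e F G"
    if F: "one_sided_load l C F" and G: "one_sided_load l B G"
      and CB: "0 \<le> B" "B \<le> C" "C + B \<le> 2 * e" for C F B G
  proof (cases "C \<le> 2 * int l")
    case True
    then show ?thesis using underloaded_of_small_credit[OF l F G] CB less.prems(5) by blast
  next
    case False
    obtain F' where F': "one_sided_load l (C - 2 * int l) F'"
      and F_le: "\<And>y. 0 \<le> y \<Longrightarrow> F (y + int l) \<le> F' y"
      using one_sided_load_merge_nearest[OF l F] by blast
    obtain a b where "1 \<le> a" "1 \<le> b" "a + b = 3 * int l + 1 + (e - int l)" "F' a + G b < 1"
      using less.hyps[of "e - int l", OF _ F' G] l CB False by (auto simp: underloaded_def)
    then show ?thesis
      using F_le[of a] unfolding underloaded_def
      by (intro exI[of _ "a + int l"] exI[of _ b]) auto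
  qed
  show ?case
  proof (cases "B \<le> C")
    case True
    then show ?thesis using ordered less.prems by blast
  next
    case False
    then have "underloaded l e G F"
      using less.prems by (intro ordered[of B G C F]) auto
    then show ?thesis by (simp only: underloaded_commute)
  qed
qed

section \<open>Credits around the cycle\<close>

definition balance :: "int \<Rightarrow> int \<Rightarrow> int" where
  "balance K g = (if g \<le> K then K - g else - 2 * (g - K) - 1)"

definition credit :: "int \<Rightarrow> nat \<Rightarrow> (nat \<Rightarrow> int) \<Rightarrow> int" where
  "credit K M g = Max ((\<lambda>k. \<Sum>t<k. balance K (g t)) ` {..M})"

lemma sum_balance_le_credit: "k \<le> M \<Longrightarrow> (\<Sum>t<k. balance K (g t)) \<le> credit K M g"
  unfolding credit_def by (intro Max_ge) auto

lemma credit_nonneg: "0 \<le> credit K M g"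
  using sum_balance_le_credit[of 0 M K g] by simp

lemma credit_le_shift:
  "credit K M g \<le> max 0 (balance K (g 0) + credit K M (\<lambda>t. g (Suc t)))"
proof -
  have "(\<Sum>t<k. balance K (g t)) \<le> max 0 (balance K (g 0) + credit K M (\<lambda>t. g (Suc t)))"
    if "k \<le> M" for k
  proof (cases k)
    case (Suc j)
    have "(\<Sum>t<k. balance K (g t)) = balance K (g 0) + (\<Sum>t<j. balance K (g (Suc t)))"
      unfolding Suc by (simp only: sum.lessThan_Suc_shift)
    then show ?thesis using sum_balance_le_credit[of j M K "\<lambda>t. g (Suc t)"] Suc that by simp
  qed simp
  then show ?thesis unfolding credit_def[of K M g] by (subst Max_le_iff) auto
qed

lemma twice_sum_add_balance_ge:
  assumes K: "1 \<le> K" and g: "\<And>t. 0 \<le> g t" and s: "s < k" "K < g s"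
  shows "(int k + 1) * K - 1 \<le> 2 * (\<Sum>t<k. g t) + (\<Sum>t<k. balance K (g t))"
proof -
  have each: "K \<le> 2 * g t + balance K (g t)" for t
    using K g[of t] by (auto simp: balance_def)
  have "(int k + 1) * K - 1 = (2 * K - 1) + (\<Sum>t\<in>{..<k} - {s}. K)"
    using s by (simp add: of_nat_diff algebra_simps)
  also have "\<dots> \<le> (2 * g s + balance K (g s)) + (\<Sum>t\<in>{..<k} - {s}. 2 * g t + balance K (g t))"
    using s by (intro add_mono sum_mono each) (auto simp: balance_def)
  also have "\<dots> = (\<Sum>t<k. 2 * g t + balance K (g t))"
    using s by (subst sum.remove[of _ s]) auto
  finally show ?thesis by (simp add: sum.distrib sum_distrib_left)
qed

lemma spread_partial_sums:
  assumes K: "1 \<le> K" and g: "\<And>t. 0 \<le> g t"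
  shows "spread K M (credit K M g) (\<lambda>k. \<Sum>t<k. g t)"
proof -
  have "int k * K - credit K M g \<le> (\<Sum>t<k. g t) \<or>
      (int k + 1) * K - 1 - credit K M g \<le> 2 * (\<Sum>t<k. g t)" if k: "k \<le> M" for k
  proof (cases "\<forall>t<k. g t \<le> K")
    case True
    then have "(\<Sum>t<k. balance K (g t)) = (\<Sum>t<k. K - g t)"
      by (intro sum.cong) (auto simp: balance_def)
    then show ?thesis using sum_balance_le_credit[OF k, of K g] by (simp add: sum_subtractf)
  next
    case False
    then obtain s where "s < k" "K < g s" by auto
    then show ?thesis
      using twice_sum_add_balance_ge[OF K g] sum_balance_le_credit[OF k, of K g] by fastforce
  qed
  then show ?thesis unfolding spread_def by (auto intro: sum_nonneg g)
qed

definition credit_behind :: "int \<Rightarrow> nat \<Rightarrow> (int \<Rightarrow> int) \<Rightarrow> int \<Rightarrow> int" where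
  "credit_behind K M g i = credit K M (\<lambda>t. g (i - 1 - int t))"

definition credit_ahead :: "int \<Rightarrow> nat \<Rightarrow> (int \<Rightarrow> int) \<Rightarrow> int \<Rightarrow> int" where
  "credit_ahead K M g i = credit K M (\<lambda>t. g (i + int t))"

lemma credit_behind_nonneg: "0 \<le> credit_behind K M g i"
  by (simp add: credit_behind_def credit_nonneg)

lemma credit_ahead_nonneg: "0 \<le> credit_ahead K M g i"
  by (simp add: credit_ahead_def credit_nonneg)

lemma credit_behind_le:
  "credit_behind K M g (i + 1) \<le> max 0 (balance K (g i) + credit_behind K M g i)"
  using credit_le_shift[of K M "\<lambda>t. g (i + 1 - 1 - int t)"]
  by (simp add: credit_behind_def algebra_simps)

lemma credit_ahead_le:
  "credit_ahead K M g i \<le> max 0 (balance K (g i) + credit_ahead K M g (i + 1))"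
  using credit_le_shift[of K M "\<lambda>t. g (i + int t)"]
  by (simp add: credit_ahead_def algebra_simps)

definition credit_potential :: "int \<Rightarrow> nat \<Rightarrow> (int \<Rightarrow> int) \<Rightarrow> int \<Rightarrow> int" where
  "credit_potential K M g i = credit_behind K M g i - credit_ahead K M g i"

lemma credit_potential_step_le:
  assumes "K < g i \<Longrightarrow> 2 * (g i - K) < credit_behind K M g i + credit_ahead K M g (i + 1)"
  shows "credit_potential K M g (i + 1) - credit_potential K M g i
           \<le> 2 * (K - g i) - of_bool (K < g i)"
  using assms credit_behind_le[of K M g i] credit_ahead_le[of K M g i]
    credit_behind_nonneg[of K M g i] credit_ahead_nonneg[of K M g "i + 1"]
  by (cases "K < g i") (auto simp: credit_potential_def balance_def max_def split: if_splits)

lemma credit_potential_periodic: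
  assumes "\<And>i. g (i + N) = g i"
  shows "credit_potential K M g (i + N) = credit_potential K M g i"
proof -
  have "g (i + N - 1 - int t) = g (i - 1 - int t)" and "g (i + N + int t) = g (i + int t)" for t
    using assms[of "i - 1 - int t"] assms[of "i + int t"] by (simp_all add: algebra_simps)
  then show ?thesis
    by (simp add: credit_potential_def credit_behind_def credit_ahead_def)
qed

lemma gaps_eq_of_excess_paid:
  assumes periodic: "\<And>i. g (i + int N) = g i"
    and total: "int N * K \<le> (\<Sum>i<N. g (int i))"
    and paid: "\<And>i. K < g i \<Longrightarrow> 2 * (g i - K) < credit_behind K M g i + credit_ahead K M g (i + 1)"
    and i: "i < N"
  shows "g (int i) = K"
proof -
  let ?P = "credit_potential K M g"
  define excess where "excess = (\<Sum>i<N. g (int i)) - int N * K"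
  define long :: int where "long = (\<Sum>i<N. of_bool (K < g (int i)))"
  have "0 = (\<Sum>i<N. ?P (int i + 1) - ?P (int i))"
    using sum_lessThan_telescope[of "\<lambda>i. ?P (int i)" N]
      credit_potential_periodic[of g "int N" K M 0, OF periodic] by (simp add: add.commute)
  also have "\<dots> \<le> (\<Sum>i<N. 2 * (K - g (int i)) - of_bool (K < g (int i)))"
    by (intro sum_mono credit_potential_step_le paid)
  also have "\<dots> = - 2 * excess - long"
    by (simp add: sum_subtractf excess_def long_def flip: sum_distrib_left)
  finally have "long + 2 * excess \<le> 0" by simp
  moreover have "0 \<le> long" unfolding long_def by (intro sum_nonneg) auto
  moreover have "0 \<le> excess" using total by (simp add: excess_def)
  ultimately have "long = 0" and "excess = 0" by auto
  have le: "g (int j) \<le> K" if "j < N" for j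
    using \<open>long = 0\<close> that unfolding long_def
    by (subst (asm) sum_nonneg_eq_0_iff) (auto simp: not_less)
  have "(\<Sum>i<N. K - g (int i)) = 0"
    using \<open>excess = 0\<close> by (simp add: excess_def sum_subtractf)
  then show ?thesis
    using le i by (subst (asm) sum_nonneg_eq_0_iff) auto
qed

section \<open>Distances in the circulant graph\<close>

lemma circ_edges_iff:
  "(u, v) \<in> circ_edges n l \<longleftrightarrow> u \<in> circ_verts n \<and> v \<in> circ_verts n \<and>
     (\<exists>i. 1 \<le> \<bar>i\<bar> \<and> \<bar>i\<bar> \<le> int l \<and> v = (u + i) mod int n)"
proof -
  have "(\<exists>i\<in>{1..int l}. v = (u + i) mod int n \<or> v = (u - i) mod int n) \<longleftrightarrow>
      (\<exists>i. 1 \<le> \<bar>i\<bar> \<and> \<bar>i\<bar> \<le> int l \<and> v = (u + i) mod int n)" (is "?L \<longleftrightarrow> ?R")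
  proof
    assume ?L
    then obtain i where "i \<in> {1..int l}" "v = (u + i) mod int n \<or> v = (u + - i) mod int n" by auto
    then show ?R by (metis abs_minus_cancel abs_of_nonneg atLeastAtMost_iff order_trans zero_le_one)
  next
    assume ?R
    then obtain i where "\<bar>i\<bar> \<in> {1..int l}" "v = (u + i) mod int n" by auto
    then show ?L by (intro bexI[of _ "\<bar>i\<bar>"]) (auto simp: abs_if)
  qed
  then show ?thesis by (auto simp: circ_edges_def)
qed

lemma circ_walk_displacement:
  assumes "(u, v) \<in> circ_edges n l ^^ k" and "u \<in> circ_verts n"
  shows "\<exists>j. \<bar>j\<bar> \<le> int k * int l \<and> v = (u + j) mod int n"
  using assms(1)
proof (induction k arbitrary: v)
  case 0
  then show ?case using assms(2) by (intro exI[of _ 0]) (auto simp: circ_verts_def)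
next
  case (Suc k)
  then obtain w where w: "(u, w) \<in> circ_edges n l ^^ k" "(w, v) \<in> circ_edges n l" by auto
  obtain j where j: "\<bar>j\<bar> \<le> int k * int l" "w = (u + j) mod int n" using Suc.IH[OF w(1)] by blast
  obtain i where i: "\<bar>i\<bar> \<le> int l" "v = (w + i) mod int n" using w(2) by (auto simp: circ_edges_iff)
  have "v = (u + (j + i)) mod int n" unfolding i(2) j(2) by (simp add: mod_simps add.assoc)
  then show ?case using j(1) i(1) by (intro exI[of _ "j + i"]) (auto simp: algebra_simps)
qed

lemma ex_circ_walk:
  assumes n: "0 < n" and u: "u \<in> circ_verts n" and "\<bar>j\<bar> \<le> int q * int l"
  shows "\<exists>k\<le>q. (u, (u + j) mod int n) \<in> circ_edges n l ^^ k"
  using assms(3)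
proof (induction q arbitrary: j)
  case 0
  then show ?case using u by (auto simp: circ_verts_def)
next
  case (Suc q)
  show ?case
  proof (cases "\<bar>j\<bar> \<le> int q * int l")
    case True
    then show ?thesis using Suc.IH by (meson le_Suc_eq)
  next
    case False
    define j' where "j' = sgn j * (int q * int l)"
    have j': "\<bar>j'\<bar> \<le> int q * int l" "1 \<le> \<bar>j - j'\<bar>" "\<bar>j - j'\<bar> \<le> int l"
      using False Suc.prems by (auto simp: j'_def sgn_if abs_if algebra_simps)
    obtain k where k: "k \<le> q" "(u, (u + j') mod int n) \<in> circ_edges n l ^^ k"
      using Suc.IH[OF j'(1)] by blast
    have "((u + j') mod int n, (u + j) mod int n) \<in> circ_edges n l"
      unfolding circ_edges_iff using n j'(2,3)
      by (auto simp: circ_verts_def mod_simps intro!: exI[of _ "j - j'"])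
    with k show ?thesis by (intro exI[of _ "Suc k"]) auto
  qed
qed

definition cyclic_dist :: "nat \<Rightarrow> int \<Rightarrow> int \<Rightarrow> int" where
  "cyclic_dist n u v = min ((v - u) mod int n) ((u - v) mod int n)"

lemma cyclic_dist_le_iff:
  assumes n: "0 < n" and v: "v \<in> circ_verts n"
  shows "cyclic_dist n u v \<le> b \<longleftrightarrow> (\<exists>j. \<bar>j\<bar> \<le> b \<and> v = (u + j) mod int n)"
proof
  assume "cyclic_dist n u v \<le> b"
  then consider "(v - u) mod int n \<le> b" | "(u - v) mod int n \<le> b"
    by (auto simp: cyclic_dist_def min_def split: if_splits)
  then show "\<exists>j. \<bar>j\<bar> \<le> b \<and> v = (u + j) mod int n"
  proof cases
    case 1
    then show ?thesis
      using n v by (intro exI[of _ "(v - u) mod int n"]) (auto simp: mod_simps circ_verts_def)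
  next
    case 2
    then show ?thesis
      using n v by (intro exI[of _ "- ((u - v) mod int n)"]) (auto simp: mod_simps circ_verts_def)
  qed
next
  assume "\<exists>j. \<bar>j\<bar> \<le> b \<and> v = (u + j) mod int n"
  then obtain j where j: "\<bar>j\<bar> \<le> b" "v = (u + j) mod int n" by blast
  have "(v - u) mod int n = j mod int n" and "(u - v) mod int n = (- j) mod int n"
    unfolding j(2) by (simp_all add: mod_simps)
  then show "cyclic_dist n u v \<le> b"
    using j(1) zmod_le_nonneg_dividend[of j "int n"] zmod_le_nonneg_dividend[of "- j" "int n"]
    by (cases "0 \<le> j") (auto simp: cyclic_dist_def min_le_iff_disj)
qed

lemma graph_dist_circ_le_iff:
  assumes n: "0 < n" and l: "0 < l" and u: "u \<in> circ_verts n" and v: "v \<in> circ_verts n"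
  shows "graph_dist (circ_edges n l) u v \<le> q \<longleftrightarrow> cyclic_dist n u v \<le> int q * int l"
proof
  define k where "k = graph_dist (circ_edges n l) u v"
  define b where "b = nat (cyclic_dist n u v)"
  have "0 \<le> cyclic_dist n u v" using n by (simp add: cyclic_dist_def)
  then have "cyclic_dist n u v \<le> int b * int l"
    using l mult_left_mono[of 1 "int l" "cyclic_dist n u v"] by (simp add: b_def)
  then have "\<exists>k. (u, v) \<in> circ_edges n l ^^ k"
    using ex_circ_walk[OF n u] unfolding cyclic_dist_le_iff[OF n v] by blast
  then have "(u, v) \<in> circ_edges n l ^^ k"
    unfolding k_def graph_dist_def by (rule LeastI_ex)
  then have "cyclic_dist n u v \<le> int k * int l"
    unfolding cyclic_dist_le_iff[OF n v] using circ_walk_displacement u by blast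
  moreover assume "graph_dist (circ_edges n l) u v \<le> q"
  then have "int k * int l \<le> int q * int l" by (intro mult_right_mono) (simp_all add: k_def)
  ultimately show "cyclic_dist n u v \<le> int q * int l" by (rule order_trans)
next
  assume "cyclic_dist n u v \<le> int q * int l"
  then have "\<exists>k\<le>q. (u, v) \<in> circ_edges n l ^^ k"
    using ex_circ_walk[OF n u] unfolding cyclic_dist_le_iff[OF n v] by blast
  then show "graph_dist (circ_edges n l) u v \<le> q"
    unfolding graph_dist_def by (meson Least_le order_trans)
qed

lemma graph_dist_circ:
  assumes "0 < n" and "0 < l" and "u \<in> circ_verts n" and "v \<in> circ_verts n"
  shows "graph_dist (circ_edges n l) u v = nat \<lceil>real_of_int (cyclic_dist n u v) / real l\<rceil>"
  using graph_dist_circ_le_iff[OF assms] nat_ceiling_divide_le_iff[OF assms(2)]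
  by (meson order_antisym order_refl)

lemma porous_exp_dominating_circ_iff:
  assumes "0 < n" and "0 < l"
  shows "porous_exp_dominating (circ_verts n) (circ_edges n l) D \<longleftrightarrow>
    D \<subseteq> circ_verts n \<and> (\<forall>v\<in>circ_verts n. 1 \<le> (\<Sum>d\<in>D. decay l (cyclic_dist n d v)))"
proof -
  have "(1 / 2 :: real) powi (int k - 1) = 2 * (1 / 2) ^ k" for k
    by (simp add: power_int_diff)
  then have "(1 / 2 :: real) powi (int (graph_dist (circ_edges n l) d v) - 1)
      = decay l (cyclic_dist n d v)" if "d \<in> circ_verts n" "v \<in> circ_verts n" for d v
    unfolding graph_dist_circ[OF assms that] decay_def by blast
  then have "(\<Sum>d\<in>D. (1 / 2 :: real) powi (int (graph_dist (circ_edges n l) d v) - 1))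
      = (\<Sum>d\<in>D. decay l (cyclic_dist n d v))" if "D \<subseteq> circ_verts n" "v \<in> circ_verts n" for v
    using that by (intro sum.cong) auto
  then show ?thesis unfolding porous_exp_dominating_def by auto
qed

lemma decay_cyclic_dist_le:
  "decay l (cyclic_dist n u v) \<le> decay l ((v - u) mod int n) + decay l ((u - v) mod int n)"
  using decay_nonneg[of l "(v - u) mod int n"] decay_nonneg[of l "(u - v) mod int n"]
  by (auto simp: cyclic_dist_def min_def)

section \<open>Residue classes as dominating sets\<close>

definition progression :: "nat \<Rightarrow> nat \<Rightarrow> int \<Rightarrow> int set" where
  "progression n K c = {v \<in> circ_verts n. v mod int K = c mod int K}"

lemma progression_subset: "progression n K c \<subseteq> circ_verts n"
  by (auto simp: progression_def)

lemma mod_in_progression_iff: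
  assumes "0 < n" and "K dvd n"
  shows "v mod int n \<in> progression n K c \<longleftrightarrow> v mod int K = c mod int K"
  using assms by (simp add: progression_def circ_verts_def mod_mod_cancel)

lemma progression_mod: "K dvd n \<Longrightarrow> progression n K (c mod int n) = progression n K c"
  by (simp add: progression_def mod_mod_cancel)

lemma progression_eq_image:
  assumes K: "0 < K" and m: "0 < m" and n: "n = K * m"
  shows "progression n K c = (\<lambda>t. (c + int (K * t)) mod int n) ` {..<m}"
proof (intro equalityI subsetI)
  fix v assume v: "v \<in> progression n K c"
  then obtain q where q: "v - c = int K * q"
    unfolding progression_def mod_eq_dvd_iff dvd_def by blast
  have t: "int (K * nat (q mod int m)) = (v - c) mod int n"
    using m by (simp add: q n)
  have "v = (c + int (K * nat (q mod int m))) mod int n"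
    unfolding t using v by (simp add: mod_simps progression_def circ_verts_def)
  moreover have "nat (q mod int m) < m" using m by (simp add: nat_less_iff)
  ultimately show "v \<in> (\<lambda>t. (c + int (K * t)) mod int n) ` {..<m}" by blast
next
  fix v assume "v \<in> (\<lambda>t. (c + int (K * t)) mod int n) ` {..<m}"
  then obtain t where v: "v = (c + int (K * t)) mod int n" by blast
  have "0 < n" and "K dvd n" using K m n by simp_all
  then show "v \<in> progression n K c" unfolding v by (simp add: mod_in_progression_iff)
qed

lemma card_progression_le:
  assumes "0 < K" and "0 < m" and "n = K * m"
  shows "card (progression n K c) \<le> m"
  unfolding progression_eq_image[OF assms] by (rule order_trans[OF card_image_le]) simp_all

lemma one_le_decay_add_decay:
  assumes l: "0 < l" and "y + z = 3 * int l + 1"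
  shows "1 \<le> decay l y + decay l z"
proof -
  consider "y \<le> int 1 * int l" | "z \<le> int 1 * int l" | "y \<le> int 2 * int l" "z \<le> int 2 * int l"
    using assms(2) by linarith
  then show ?thesis
  proof cases
    case 1
    then show ?thesis using power_le_decay[OF l 1] decay_nonneg[of l z] by simp
  next
    case 2
    then show ?thesis using power_le_decay[OF l 2] decay_nonneg[of l y] by simp
  next
    case 3
    have "2 * (1 / 2) ^ 2 + 2 * (1 / 2) ^ 2 \<le> decay l y + decay l z"
      by (intro add_mono power_le_decay[OF l] 3)
    then show ?thesis by (simp add: power2_eq_square)
  qed
qed

lemma porous_exp_dominating_progression:
  assumes l: "0 < l" and m: "2 \<le> m" and n: "n = (3 * l + 1) * m"
  shows "porous_exp_dominating (circ_verts n) (circ_edges n l) (progression n (3 * l + 1) c)"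
proof -
  define K where "K = 3 * l + 1"
  have "n = K * m" and K: "0 < K" by (simp_all add: K_def n)
  then have n0: "0 < n" and "K dvd n" and "K < n" using m by simp_all
  let ?D = "progression n K c"
  have "1 \<le> (\<Sum>d\<in>?D. decay l (cyclic_dist n d v))" if v: "v \<in> circ_verts n" for v
  proof -
    define r where "r = (v - c) mod int K"
    define d where "d = (v - r) mod int n"
    define d' where "d' = (v - r + int K) mod int n"
    have r: "0 \<le> r" "r < int K" using K by (simp_all add: r_def)
    have "(v - r) mod int K = c mod int K" by (simp add: r_def mod_simps)
    then have D: "d \<in> ?D" "d' \<in> ?D"
      using n0 \<open>K dvd n\<close> by (simp_all add: d_def d'_def mod_in_progression_iff)
    have "v = (d + r) mod int n" and "v = (d' + (r - int K)) mod int n"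
      using v by (simp_all add: d_def d'_def mod_simps circ_verts_def)
    then have dist: "cyclic_dist n d v \<le> r" "cyclic_dist n d' v \<le> int K - r"
      unfolding cyclic_dist_le_iff[OF n0 v]
      using r by (intro exI[of _ r] exI[of _ "r - int K"]; simp)+
    have "\<not> int n dvd int K" using K \<open>K < n\<close> by (simp add: nat_dvd_not_less)
    then have neq: "d \<noteq> d'" unfolding d_def d'_def by (auto simp: mod_eq_dvd_iff)
    have "1 \<le> decay l r + decay l (int K - r)"
      by (intro one_le_decay_add_decay[OF l]) (simp add: K_def)
    also have "\<dots> \<le> (\<Sum>d\<in>{d, d'}. decay l (cyclic_dist n d v))"
      using neq dist by (simp add: add_mono decay_antimono)
    also have "\<dots> \<le> (\<Sum>d\<in>?D. decay l (cyclic_dist n d v))"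
      using D finite_subset[OF progression_subset[of n K c]]
      by (intro sum_mono2) (auto simp: decay_nonneg circ_verts_def)
    finally show ?thesis .
  qed
  then show ?thesis
    using n0 l progression_subset by (auto simp: porous_exp_dominating_circ_iff K_def)
qed

lemma bij_betw_mod_window:
  assumes "0 < n"
  shows "bij_betw (\<lambda>k. k mod int n) {i..<i + int n} {0..<int n}"
proof -
  have "inj_on (\<lambda>k. k mod int n) {i..<i + int n}"
  proof (rule inj_onI)
    fix a b assume a: "a \<in> {i..<i + int n}" and b: "b \<in> {i..<i + int n}"
      and "a mod int n = b mod int n"
    then have "(a - i) mod int n = (b - i) mod int n" by (metis mod_diff_left_eq)
    then show "a = b" using a b by simp
  qed
  moreover have "(\<lambda>k. k mod int n) ` {i..<i + int n} \<subseteq> {0..<int n}" using assms by auto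
  ultimately show ?thesis by (simp add: bij_betw_def card_image card_subset_eq)
qed

lemma card_circ_interval:
  assumes "0 < n"
  shows "int (card (circ_interval n i j)) = (j - i) mod int n + 1"
proof -
  have "{i..i + (j - i) mod int n} \<subseteq> {i..<i + int n}"
    using assms pos_mod_bound[of "int n" "j - i"] by (auto simp del: pos_mod_bound)
  then have "inj_on (\<lambda>k. k mod int n) {i..i + (j - i) mod int n}"
    using bij_betw_mod_window[OF assms] by (metis bij_betw_imp_inj_on inj_on_subset)
  then show ?thesis using assms by (simp add: circ_interval_def card_image)
qed

lemma card_circ_interval_inter_progression:
  assumes n: "0 < n" and K: "0 < K" "K dvd n" and ij: "(j - i) mod int n = int K - 1"
  shows "card (circ_interval n i j \<inter> progression n K c) = 1"
proof -
  define r where "r = (c - i) mod int K"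
  have r: "0 \<le> r" "r < int K" using K(1) by (auto simp: r_def)
  have "k mod int K = c mod int K \<longleftrightarrow> k = i + r" if "k \<in> {i..i + (int K - 1)}" for k
  proof
    assume "k mod int K = c mod int K"
    then have "(k - i) mod int K = r" unfolding r_def by (metis mod_diff_left_eq)
    then show "k = i + r" using that by simp
  qed (simp add: r_def mod_simps)
  then have "circ_interval n i j \<inter> progression n K c = {(i + r) mod int n}"
    using r by (auto simp: circ_interval_def ij mod_in_progression_iff[OF n K(2)])
  then show ?thesis by simp
qed

lemma interval_partition_progression:
  assumes n: "0 < n" and K: "0 < K" "K dvd n" and m: "0 < m"
    and I: "interval_partition n m I" "\<And>k. k < m \<Longrightarrow> card (I k) = K"
  shows "f_star m (progression n K c) I = 1" and "Z_count m (progression n K c) I = 0"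
proof -
  have f: "f_count (progression n K c) I k = 1" if k: "k < m" for k
  proof -
    obtain a b where ab: "I k = circ_interval n a b"
      using I(1) k by (auto simp: interval_partition_def)
    then have "(b - a) mod int n = int K - 1"
      using card_circ_interval[OF n, of a b] I(2)[OF k] by simp
    then show ?thesis
      using card_circ_interval_inter_progression[OF n K] by (simp add: f_count_def ab)
  qed
  then have "f_count (progression n K c) I ` {..<m} = {1}" using m by force
  then show "f_star m (progression n K c) I = 1" by (simp add: f_star_def)
  show "Z_count m (progression n K c) I = 0" using f by (simp add: Z_count_def z_set_def)
qed

definition rotation :: "nat \<Rightarrow> int \<Rightarrow> int \<Rightarrow> int" where
  "rotation n a v = (v + a) mod int n"

lemma rotation_minus_cancel:
  assumes "v \<in> circ_verts n"
  shows "rotation n a (rotation n (- a) v) = v" and "rotation n (- a) (rotation n a v) = v"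
  using assms by (auto simp: rotation_def circ_verts_def mod_simps)

lemma graph_automorphism_rotation:
  assumes n: "0 < n"
  shows "graph_automorphism (circ_verts n) (circ_edges n l) (rotation n a)"
  unfolding graph_automorphism_def
proof (intro conjI ballI)
  have verts: "rotation n b v \<in> circ_verts n" for b v
    using n by (simp add: rotation_def circ_verts_def)
  show "bij_betw (rotation n a) (circ_verts n) (circ_verts n)"
    by (rule bij_betw_byWitness[of _ "rotation n (- a)"])
      (auto simp: rotation_minus_cancel verts)
  have edge: "(rotation n b u, rotation n b v) \<in> circ_edges n l"
    if "(u, v) \<in> circ_edges n l" for b u v
  proof -
    have "rotation n b ((u + i) mod int n) = (rotation n b u + i) mod int n" for i
      by (simp add: rotation_def mod_simps ac_simps)
    then show ?thesis using that by (auto simp: circ_edges_iff verts)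
  qed
  show "(u, v) \<in> circ_edges n l \<longleftrightarrow> (rotation n a u, rotation n a v) \<in> circ_edges n l"
    if "u \<in> circ_verts n" "v \<in> circ_verts n" for u v
    using edge[of u v a] edge[of "rotation n a u" "rotation n a v" "- a"] that
    by (auto simp: rotation_minus_cancel)
qed

lemma rotation_image_progression:
  assumes n: "0 < n" and K: "K dvd n"
  shows "rotation n a ` progression n K c = progression n K (c + a)"
proof (intro equalityI subsetI)
  fix v assume "v \<in> rotation n a ` progression n K c"
  then obtain u where "v = (u + a) mod int n" "u mod int K = c mod int K"
    by (auto simp: rotation_def progression_def)
  then show "v \<in> progression n K (c + a)"
    by (auto simp: mod_in_progression_iff[OF n K] intro: mod_add_cong)
next
  fix v assume v: "v \<in> progression n K (c + a)"
  then have "(v - a) mod int K = (c + a - a) mod int K"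
    unfolding progression_def by (intro mod_diff_cong) auto
  then have "rotation n (- a) v \<in> progression n K c"
    by (simp add: rotation_def mod_in_progression_iff[OF n K])
  moreover have "rotation n a (rotation n (- a) v) = v"
    using v progression_subset by (intro rotation_minus_cancel) blast
  ultimately show "v \<in> rotation n a ` progression n K c" by (metis imageI)
qed

lemma ex_automorphism_between_progressions:
  assumes "0 < n" and "K dvd n"
  shows "\<exists>\<phi>. graph_automorphism (circ_verts n) (circ_edges n l) \<phi> \<and>
           \<phi> ` progression n K c = progression n K c'"
  using graph_automorphism_rotation[OF assms(1)] rotation_image_progression[OF assms, of "c' - c" c]
  by auto

section \<open>Long gaps are impossible\<close>

locale cyclic_enum =
  fixes n :: nat and D :: "int set" and p :: "int \<Rightarrow> int"
  assumes card_pos: "0 < card D"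
    and strict_mono: "strict_mono p"
    and add_card: "p (i + int (card D)) = p i + int n"
    and bij_betw_window: "bij_betw (\<lambda>j. p j mod int n) {i..<i + int (card D)} D"
begin

definition gap :: "int \<Rightarrow> int" where
  "gap i = p (i + 1) - p i"

lemma gap_pos: "0 < gap i"
  using strict_monoD[OF strict_mono, of i "i + 1"] by (simp add: gap_def)

lemma gap_add_card: "gap (i + int (card D)) = gap i"
  using add_card[of i] add_card[of "i + 1"] by (simp add: gap_def algebra_simps)

lemma sum_gap_behind: "(\<Sum>t<k. gap (i - 1 - int t)) = p i - p (i - int k)"
  by (induction k) (auto simp: gap_def algebra_simps)

lemma sum_gap_ahead: "(\<Sum>t<k. gap (i + int t)) = p (i + int k) - p i"
  by (induction k) (auto simp: gap_def algebra_simps)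

lemma period_pos: "0 < n"
  using strict_monoD[OF strict_mono, of 0 "int (card D)"] add_card[of 0] card_pos by simp

lemma bij_betw_ahead: "bij_betw (\<lambda>k. p (i + int k) mod int n) {..card D - 1} D"
proof -
  have "bij_betw (\<lambda>k. i + int k) {..card D - 1} {i..<i + int (card D)}"
    using card_pos by (intro bij_betw_byWitness[of _ "\<lambda>j. nat (j - i)"]) auto
  then show ?thesis using bij_betw_trans[OF _ bij_betw_window] by (simp add: comp_def)
qed

lemma bij_betw_behind: "bij_betw (\<lambda>k. p (i - int k) mod int n) {..card D - 1} D"
proof -
  let ?i = "i + 1 - int (card D)"
  have "bij_betw (\<lambda>k. i - int k) {..card D - 1} {?i..<?i + int (card D)}"
    using card_pos by (intro bij_betw_byWitness[of _ "\<lambda>j. nat (i - j)"]) auto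
  then show ?thesis using bij_betw_trans[OF _ bij_betw_window[of ?i]] by (simp add: comp_def)
qed

definition load_behind :: "nat \<Rightarrow> int \<Rightarrow> int \<Rightarrow> real" where
  "load_behind l i = load l (card D - 1) (\<lambda>k. \<Sum>t<k. gap (i - 1 - int t))"

definition load_ahead :: "nat \<Rightarrow> int \<Rightarrow> int \<Rightarrow> real" where
  "load_ahead l i = load l (card D - 1) (\<lambda>k. \<Sum>t<k. gap (i + int t))"

lemma sum_decay_behind:
  assumes "0 \<le> a" and "a < gap i"
  shows "(\<Sum>d\<in>D. decay l ((p i + a - d) mod int n)) = load_behind l i a"
proof -
  have "(p i + a - p (i - int k)) mod int n = a + (p i - p (i - int k))" if "k \<le> card D - 1" for k
  proof -
    have "p (i - int k) \<le> p i" and "p (i + 1 - int (card D)) \<le> p (i - int k)"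
      using that card_pos by (auto intro!: monoD[OF strict_mono_mono[OF strict_mono]])
    then show ?thesis
      using assms add_card[of "i + 1 - int (card D)"] by (simp add: gap_def)
  qed
  then show ?thesis
    unfolding sum.reindex_bij_betw[OF bij_betw_behind[of i], symmetric]
    by (simp add: load_behind_def load_def sum_gap_behind mod_simps)
qed

lemma sum_decay_ahead:
  assumes "0 \<le> b" and "b < gap i"
  shows "(\<Sum>d\<in>D. decay l ((d - (p (i + 1) - b)) mod int n)) = load_ahead l (i + 1) b"
proof -
  have "(p (i + 1 + int k) - (p (i + 1) - b)) mod int n = b + (p (i + 1 + int k) - p (i + 1))"
    if "k \<le> card D - 1" for k
  proof -
    have "p (i + 1) \<le> p (i + 1 + int k)" and "p (i + 1 + int k) \<le> p (i + int (card D))"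
      using that card_pos by (auto intro!: monoD[OF strict_mono_mono[OF strict_mono]])
    then show ?thesis using assms add_card[of i] by (simp add: gap_def)
  qed
  then show ?thesis
    unfolding sum.reindex_bij_betw[OF bij_betw_ahead[of "i + 1"], symmetric]
    by (simp add: load_ahead_def load_def sum_gap_ahead mod_simps)
qed

lemma sum_decay_cyclic_dist_le:
  assumes "0 < a" and "0 < b" and "a + b = gap i"
  shows "(\<Sum>d\<in>D. decay l (cyclic_dist n d ((p i + a) mod int n)))
           \<le> load_behind l i a + load_ahead l (i + 1) b"
proof -
  let ?v = "(p i + a) mod int n"
  have v: "p (i + 1) - b = p i + a" using assms(3) by (simp add: gap_def)
  have "(\<Sum>d\<in>D. decay l (cyclic_dist n d ?v))
      \<le> (\<Sum>d\<in>D. decay l ((?v - d) mod int n) + decay l ((d - ?v) mod int n))"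
    by (intro sum_mono decay_cyclic_dist_le)
  also have "\<dots> = load_behind l i a + load_ahead l (i + 1) b"
    using sum_decay_behind[of a i l] sum_decay_ahead[of b i l] assms
    by (simp add: sum.distrib mod_simps v)
  finally show ?thesis .
qed

lemma one_sided_load_behind:
  "one_sided_load l (credit_behind (3 * int l + 1) (card D - 1) gap i) (load_behind l i)"
  using spread_partial_sums[of "3 * int l + 1" "\<lambda>t. gap (i - 1 - int t)" "card D - 1"] gap_pos
  unfolding one_sided_load_def load_behind_def credit_behind_def by (fastforce intro: less_imp_le)

lemma one_sided_load_ahead:
  "one_sided_load l (credit_ahead (3 * int l + 1) (card D - 1) gap i) (load_ahead l i)"
  using spread_partial_sums[of "3 * int l + 1" "\<lambda>t. gap (i + int t)" "card D - 1"] gap_pos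
  unfolding one_sided_load_def load_ahead_def credit_ahead_def by (fastforce intro: less_imp_le)

lemma excess_paid_of_dominating:
  assumes l: "0 < l" and dom: "porous_exp_dominating (circ_verts n) (circ_edges n l) D"
    and K: "K = 3 * int l + 1" and long: "K < gap i"
  shows "2 * (gap i - K)
           < credit_behind K (card D - 1) gap i + credit_ahead K (card D - 1) gap (i + 1)"
proof (rule ccontr)
  assume "\<not> ?thesis"
  then have "underloaded l (gap i - K) (load_behind l i) (load_ahead l (i + 1))"
    using long unfolding K
    by (intro underloaded_of_credit_le[OF l one_sided_load_behind one_sided_load_ahead]
        credit_behind_nonneg credit_ahead_nonneg) auto
  then obtain a b where ab: "1 \<le> a" "1 \<le> b" "a + b = gap i"
    and less: "load_behind l i a + load_ahead l (i + 1) b < 1"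
    by (auto simp: underloaded_def K)
  have "(p i + a) mod int n \<in> circ_verts n" using period_pos by (simp add: circ_verts_def)
  then have "1 \<le> (\<Sum>d\<in>D. decay l (cyclic_dist n d ((p i + a) mod int n)))"
    using dom by (simp add: porous_exp_dominating_circ_iff[OF period_pos l])
  also have "\<dots> \<le> load_behind l i a + load_ahead l (i + 1) b"
    using ab by (intro sum_decay_cyclic_dist_le) auto
  finally show False using less by simp
qed

lemma eq_progression_of_gap_eq:
  assumes K: "0 < K" and gap: "\<And>i. i < card D \<Longrightarrow> gap (int i) = int K"
  shows "D = progression n K (p 0)"
proof -
  have p: "p (int k) = p 0 + int (K * k)" if "k \<le> card D" for k
  proof -
    have "p (int k) - p 0 = (\<Sum>t<k. gap (int t))" using sum_gap_ahead[of 0 k] by simp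
    also have "\<dots> = (\<Sum>t<k. int K)" using that by (intro sum.cong gap) auto
    finally show ?thesis by (simp add: mult.commute)
  qed
  have n: "n = K * card D" using p[of "card D"] add_card[of 0] by (simp flip: of_nat_mult)
  have "D = (\<lambda>k. p (int k) mod int n) ` {..card D - 1}"
    using bij_betw_ahead[of 0] by (simp add: bij_betw_def)
  also have "{..card D - 1} = {..<card D}" using card_pos by auto
  also have "(\<lambda>k. p (int k) mod int n) ` {..<card D}
      = (\<lambda>k. (p 0 + int (K * k)) mod int n) ` {..<card D}"
    by (intro image_cong) (simp_all add: p)
  also have "\<dots> = progression n K (p 0)" by (rule progression_eq_image[OF K card_pos n, symmetric])
  finally show ?thesis .
qed

lemma eq_progression_of_dominating:
  assumes l: "0 < l" and n: "n = (3 * l + 1) * m" and card: "card D \<le> m"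
    and dom: "porous_exp_dominating (circ_verts n) (circ_edges n l) D"
  shows "D = progression n (3 * l + 1) (p 0)"
proof (rule eq_progression_of_gap_eq)
  fix i assume i: "i < card D"
  show "gap (int i) = int (3 * l + 1)"
  proof (rule gaps_eq_of_excess_paid[OF gap_add_card _ excess_paid_of_dominating[OF l dom] i])
    have "(\<Sum>i<card D. gap (int i)) = int n"
      using sum_gap_ahead[of 0 "card D"] add_card[of 0] by simp
    then show "int (card D) * int (3 * l + 1) \<le> (\<Sum>i<card D. gap (int i))"
      using mult_le_mono1[OF card, of "3 * l + 1"]
      by (simp only: n mult.commute of_nat_le_iff flip: of_nat_mult)
  qed simp_all
qed simp

end

text \<open>Enumerates in increasing order, from the least element of \<open>D\<close> at index \<open>0\<close>, all integers
  congruent modulo \<open>n\<close> to an element of \<open>D\<close>.\<close>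

definition lift_enum :: "nat \<Rightarrow> int set \<Rightarrow> int \<Rightarrow> int" where
  "lift_enum n D i =
     sorted_list_of_set D ! nat (i mod int (card D)) + int n * (i div int (card D))"

lemma strict_mono_lift_enum:
  assumes D: "D \<subseteq> {0..<int n}" "D \<noteq> {}"
  shows "strict_mono (lift_enum n D)"
proof (rule strict_monoI)
  fix i j :: int assume "i < j"
  let ?N = "int (card D)" and ?L = "sorted_list_of_set D"
  have fin: "finite D" using D(1) finite_subset by blast
  then have N: "0 < ?N" using D(2) by (simp add: card_gt_0_iff)
  have nat_mod: "nat (k mod ?N) < length ?L" for k using N fin by (simp add: nat_less_iff)
  have "?L ! nat (k mod ?N) \<in> D" for k using nth_mem[OF nat_mod] fin by simp
  then have L: "0 \<le> ?L ! nat (k mod ?N)" "?L ! nat (k mod ?N) < int n" for k using D(1) by force+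
  have "i div ?N \<le> j div ?N" using \<open>i < j\<close> N by (intro zdiv_mono1) auto
  then consider "i div ?N = j div ?N" | "i div ?N + 1 \<le> j div ?N" by linarith
  then show "lift_enum n D i < lift_enum n D j"
  proof cases
    case 1
    then have "j = i div ?N * ?N + j mod ?N" by simp
    moreover have "i = i div ?N * ?N + i mod ?N" by simp
    ultimately have "i mod ?N < j mod ?N" using \<open>i < j\<close> by linarith
    then have "nat (i mod ?N) < nat (j mod ?N)"
      by (rule nat_less_eq_zless[THEN iffD2, rotated]) (use N in simp)
    then have "?L ! nat (i mod ?N) < ?L ! nat (j mod ?N)"
      using sorted_wrt_nth_less[OF strict_sorted_list_of_set _ nat_mod] by blast
    then show ?thesis using 1 by (simp add: lift_enum_def)
  next
    case 2
    then have "int n * (i div ?N + 1) \<le> int n * (j div ?N)" by (intro mult_left_mono) auto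
    then show ?thesis using L(2)[of i] L(1)[of j] by (simp add: lift_enum_def algebra_simps)
  qed
qed

lemma bij_betw_lift_enum:
  assumes D: "D \<subseteq> {0..<int n}" "D \<noteq> {}"
  shows "bij_betw (\<lambda>j. lift_enum n D j mod int n) {i..<i + int (card D)} D"
proof -
  let ?N = "int (card D)" and ?L = "sorted_list_of_set D"
  have fin: "finite D" using D(1) finite_subset by blast
  then have N: "0 < card D" using D(2) by (simp add: card_gt_0_iff)
  have "bij_betw nat {0..<?N} {..<card D}"
    by (rule bij_betw_byWitness[of _ int]) auto
  moreover have nth: "bij_betw ((!) ?L) {..<card D} D"
    using fin by (intro bij_betw_nth) auto
  ultimately have "bij_betw ((!) ?L \<circ> (nat \<circ> (\<lambda>j. j mod ?N))) {i..<i + ?N} D"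
    using bij_betw_mod_window[OF N] by (intro bij_betw_trans)
  moreover have "lift_enum n D j mod int n = ?L ! nat (j mod ?N)" for j
  proof -
    have "nat (j mod ?N) < card D" using N by (simp add: nat_less_iff)
    then have "?L ! nat (j mod ?N) \<in> D" using nth by (auto simp: bij_betw_def)
    then show ?thesis using D(1) by (auto simp: lift_enum_def)
  qed
  ultimately show ?thesis by (simp add: comp_def)
qed

lemma cyclic_enum_lift_enum:
  assumes "D \<subseteq> {0..<int n}" and "D \<noteq> {}"
  shows "cyclic_enum n D (lift_enum n D)"
proof
  have "finite D" using assms(1) finite_subset by blast
  then show "0 < card D" using assms(2) by (simp add: card_gt_0_iff)
  then show "lift_enum n D (i + int (card D)) = lift_enum n D i + int n" for i
    by (simp add: lift_enum_def distrib_left)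
qed (rule strict_mono_lift_enum[OF assms] bij_betw_lift_enum[OF assms])+

lemma min_porous_exp_dominating_imp_progression:
  assumes l: "1 \<le> l" and m: "2 \<le> m" and n: "n = (3 * l + 1) * m"
    and D: "min_porous_exp_dominating (circ_verts n) (circ_edges n l) D"
  obtains c where "c \<in> circ_verts n" and "D = progression n (3 * l + 1) c"
proof -
  have l0: "0 < l" and n0: "0 < n" using l m by (simp_all add: n)
  have dom: "porous_exp_dominating (circ_verts n) (circ_edges n l) D"
    using D by (simp add: min_porous_exp_dominating_def)
  then have "D \<subseteq> {0..<int n}"
    by (simp add: porous_exp_dominating_def circ_verts_def)
  moreover have "0 \<in> circ_verts n" using n0 by (simp add: circ_verts_def)
  then have "D \<noteq> {}" using dom by (auto simp: porous_exp_dominating_def)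
  ultimately interpret cyclic_enum n D "lift_enum n D"
    by (rule cyclic_enum_lift_enum)
  have "card D \<le> card (progression n (3 * l + 1) 0)"
    using D porous_exp_dominating_progression[OF l0 m n]
    by (simp add: min_porous_exp_dominating_def)
  also have "\<dots> \<le> m" using m by (intro card_progression_le n) auto
  finally have "D = progression n (3 * l + 1) (lift_enum n D 0)"
    by (rule eq_progression_of_dominating[OF l0 n _ dom])
  also have "\<dots> = progression n (3 * l + 1) (lift_enum n D 0 mod int n)"
    unfolding n by (intro progression_mod[symmetric] dvd_triv_left)
  finally show thesis using n0 by (intro that) (simp_all add: circ_verts_def)
qed

theorem theorem2:
  fixes l m n :: nat and D :: "int set"
  assumes "l \<ge> 1" and "m \<ge> 2" and "n = (3 * l + 1) * m"
    and "min_porous_exp_dominating (circ_verts n) (circ_edges n l) D"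
  shows "(\<forall>s::int. \<forall>i<m.
            card (circ_interval n (s + int ((3 * l + 1) * i))
                    (s + int ((3 * l + 1) * i) + 3 * int l) \<inter> D) = 1)
       \<and> (\<forall>I. interval_partition n m I \<and> (\<forall>k<m. card (I k) = 3 * l + 1) \<longrightarrow>
            f_star m D I = 1 \<and> Z_count m D I = 0)
       \<and> (\<forall>D'. min_porous_exp_dominating (circ_verts n) (circ_edges n l) D' \<longrightarrow>
            (\<exists>\<phi>. graph_automorphism (circ_verts n) (circ_edges n l) \<phi> \<and> \<phi> ` D = D'))
       \<and> (\<exists>c\<in>circ_verts n. D = {(c + int ((3 * l + 1) * t)) mod int n | t. t < m})"
proof -
  define K where "K = 3 * l + 1"
  have "n = K * m" and K: "0 < K" using assms(3) by (simp_all add: K_def)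
  then have n: "0 < n" and K_dvd: "K dvd n" and "K < n" and m: "0 < m" using assms(2) by simp_all
  obtain c where c: "c \<in> circ_verts n" and D: "D = progression n K c"
    using min_porous_exp_dominating_imp_progression[OF assms] unfolding K_def .
  show ?thesis
  proof (intro conjI allI impI)
    show "card (circ_interval n (s + int ((3 * l + 1) * i))
                    (s + int ((3 * l + 1) * i) + 3 * int l) \<inter> D) = 1" for s :: int and i
      unfolding D using \<open>K < n\<close>
      by (intro card_circ_interval_inter_progression[OF n K K_dvd]) (simp add: K_def)
  next
    fix I assume "interval_partition n m I \<and> (\<forall>k<m. card (I k) = 3 * l + 1)"
    then show "f_star m D I = 1" and "Z_count m D I = 0"
      unfolding D using interval_partition_progression[OF n K K_dvd m] by (simp_all add: K_def)
  next
    fix D' assume "min_porous_exp_dominating (circ_verts n) (circ_edges n l) D'"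
    then obtain c' where "D' = progression n K c'"
      using min_porous_exp_dominating_imp_progression[OF assms(1-3)] unfolding K_def by blast
    then show "\<exists>\<phi>. graph_automorphism (circ_verts n) (circ_edges n l) \<phi> \<and> \<phi> ` D = D'"
      unfolding D using ex_automorphism_between_progressions[OF n K_dvd] by simp
  next
    show "\<exists>c\<in>circ_verts n. D = {(c + int ((3 * l + 1) * t)) mod int n | t. t < m}"
      using c progression_eq_image[OF K m \<open>n = K * m\<close>] by (auto simp: D K_def image_def)
  qed
qed

end
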